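(* Let $p(z)\in \mathbb{Z}[z]$ be a non-odd polynomial of degree $d\geq 2$ with a positive leading coefficient. Then there exists an integer $n_0$ such that the following holds for all integers $n\geq n_0$: for every $2$-coloring $\phi$ of the integer interval $[n, p(\lceil \frac{1}{2}p(n) \rceil)]=\{n,n+1,\dots,p(\lceil \frac{1}{2}p(n) \rceil)\}$, there exist numbers $x,y,z\in [n, p(\lceil \frac{1}{2}p(n)\rceil)]$ (not necessarily distinct) all of the same color under $\phi$ and satisfying $x+y=p(z)$.
   Context: A polynomial $p\in\mathbb{Z}[z]$ is called odd if $p(z)$ is an odd integer for every $z\in\mathbb{Z}$, and non-odd otherwise. *)

theory Defs
  imports Complex_Main "HOL-Library.FuncSet" "HOL-Computational_Algebra.Polynomial"
begin

definition odd_poly :: "int poly \<Rightarrow> bool" where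
  "odd_poly p \<longleftrightarrow> (\<forall>z::int. odd (poly p z))"

end

theory Submission
  imports Defs
begin

text \<open>
  Suppose a colouring has no monochromatic solution. If \<open>z\<close> is red and \<open>w\<close> is blue, then the red set is
  closed under translation by \<open>p(w) - p(z)\<close>, as long as everything stays in the interval.

  The interval \<open>[n, M]\<close> with \<open>M = \<lceil>p(n)/2\<rceil>\<close> is not monochromatic, because \<open>M + (p(n) - M) = p(n)\<close>.
  So it begins with a maximal block \<open>[n, v]\<close>, red say, and \<open>v + 1\<close> is blue.

  A monochromatic block \<open>[s, v]\<close> followed by a change of colour has \<open>v < 2s\<close>. Otherwise the
  \<open>d\<close>-th differences of \<open>p\<close> with steps \<open>h = 1, 2, 4, \<dots>\<close> inside the block turn the translations
  \<open>p(v+1) - p(z)\<close>, \<open>z \<in> [s, v]\<close>, into pairs of sums that differ by exactly \<open>d! a h^d\<close>, where \<open>a\<close> is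
  the leading coefficient. Hence sums of translations reach every sufficiently large number up to a
  bounded error, and one of them carries \<open>s\<close> to \<open>p(v) - x\<close> for some \<open>x\<close> in the block.

  So \<open>v < 2n\<close>. Then \<open>v + (p(v+1) - p(v)) \<le> M\<close> is red, and the next change, from a blue \<open>u\<close> to a red
  \<open>u + 1\<close>, has \<open>u < 2(v+1)\<close>. The red set is now closed under adding \<open>A = p(v+1) - p(v)\<close> and under
  subtracting \<open>B = p(u+1) - p(u)\<close>, and this makes it \<open>A\<close>-periodic. But one of \<open>p(v)\<close>, \<open>p(v+1)\<close> is
  even, and halving it gives a blue \<open>y\<close> with \<open>y + A\<close> red.
\<close>

section \<open>Differences and growth of integer polynomials\<close>

definition backward_diff :: "int \<Rightarrow> int poly \<Rightarrow> int poly" where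
  "backward_diff h r = r - pcompose r [:- h, 1:]"

lemma poly_backward_diff: "poly (backward_diff h r) z = poly r z - poly r (z - h)"
  by (simp add: backward_diff_def poly_pcompose algebra_simps)

text \<open>Product rule for \<open>z * r(z)\<close>, which drives the coefficient induction in the
  next lemma.\<close>

lemma backward_diff_pCons:
  "backward_diff h (pCons a r) = pCons 0 (backward_diff h r) - smult h (backward_diff h r) + smult h r"
  by (simp add: backward_diff_def pcompose_pCons algebra_simps smult_diff_right)

lemma backward_diff_degree_coeff:
  assumes "degree r \<le> Suc k"
  shows "degree (backward_diff h r) \<le> k \<and> coeff (backward_diff h r) k = int (Suc k) * h * coeff r (Suc k)"
  using assms
proof (induction r arbitrary: k rule: pCons_induct)
  case 0
  then show ?case by (simp add: backward_diff_def)
next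
  case (pCons a r)
  show ?case
  proof (cases k)
    case 0
    then have "degree r \<le> 0"
      using pCons.prems by (simp split: if_splits)
    then obtain b where b: "r = [:b:]"
      by (metis degree_eq_zeroE le_zero_eq)
    show ?thesis
      unfolding backward_diff_pCons b using 0 by (simp add: backward_diff_def)
  next
    case (Suc j)
    have "degree r \<le> Suc j"
      using pCons.prems Suc by (simp split: if_splits)
    moreover from pCons.IH[OF this]
    have IH: "degree (backward_diff h r) \<le> j"
      "coeff (backward_diff h r) j = int (Suc j) * h * coeff r (Suc j)"
      by auto
    moreover have "coeff (backward_diff h r) k = 0"
      using IH(1) Suc by (simp add: coeff_eq_0)
    moreover have "degree (pCons 0 (backward_diff h r)) \<le> k"
      using IH(1) Suc by (simp add: degree_pCons_eq_if)
    ultimately show ?thesis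
      unfolding backward_diff_pCons using Suc
      by (auto intro!: degree_add_le degree_diff_le simp: algebra_simps
          intro: order_trans[OF degree_smult_le])
  qed
qed

text \<open>Each difference lowers the degree and multiplies the top coefficient by \<open>h\<close>
  and the old degree bound; \<open>fact k\<close> on the left avoids the quotient
  \<open>fact (j + k) / fact k\<close>.\<close>

lemma backward_diff_funpow:
  assumes "degree r \<le> j + k"
  shows "degree ((backward_diff h ^^ j) r) \<le> k \<and>
    fact k * coeff ((backward_diff h ^^ j) r) k = fact (j + k) * h ^ j * coeff r (j + k)"
  using assms
proof (induction j arbitrary: k)
  case 0
  then show ?case by simp
next
  case (Suc j)
  let ?r = "(backward_diff h ^^ j) r"
  have IH: "degree ?r \<le> Suc k"
    "fact (Suc k) * coeff ?r (Suc k) = fact (j + Suc k) * h ^ j * coeff r (j + Suc k)"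
    using Suc.IH[of "Suc k"] Suc.prems by auto
  have "fact k * (int (Suc k) * h * coeff ?r (Suc k)) = h * (fact (Suc k) * coeff ?r (Suc k))"
    by (simp add: algebra_simps)
  also have "\<dots> = fact (Suc j + k) * h ^ Suc j * coeff r (Suc j + k)"
    unfolding IH(2) by (simp add: mult_ac)
  finally show ?case
    using backward_diff_degree_coeff[OF IH(1), of h] by simp
qed

lemma poly_backward_diff_funpow_degree:
  assumes "degree r \<le> d"
  shows "poly ((backward_diff h ^^ d) r) z = fact d * h ^ d * coeff r d"
proof -
  let ?r = "(backward_diff h ^^ d) r"
  have "degree ?r \<le> 0" "coeff ?r 0 = fact d * h ^ d * coeff r d"
    using backward_diff_funpow[of r d 0 h] assms by auto
  then show ?thesis
    by (metis add_0_right coeff_pCons_0 degree_eq_zeroE le_zero_eq mult_zero_right poly_0 poly_pCons)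
qed

text \<open>Horner form: \<open>a + z * r(z) \<ge> a + z\<close> once \<open>z \<ge> 0\<close> and
  the tail is at least 1.\<close>

lemma eventually_poly_pos:
  fixes r :: "int poly"
  assumes "lead_coeff r > 0"
  shows "\<exists>z0. \<forall>z\<ge>z0. poly r z \<ge> 1"
  using assms
proof (induction r rule: pCons_induct)
  case 0
  then show ?case by simp
next
  case (pCons a r)
  show ?case
  proof (cases "r = 0")
    case True
    then show ?thesis using pCons.prems by (auto intro!: exI[of _ 0])
  next
    case False
    then obtain z0 where z0: "\<forall>z\<ge>z0. poly r z \<ge> 1"
      using pCons.IH pCons.prems by auto
    have "poly (pCons a r) z \<ge> 1" if "z \<ge> max z0 (max 0 (1 - a))" for z
    proof -
      have "z * 1 \<le> z * poly r z"
        using z0 that by (intro mult_left_mono) auto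
      then show ?thesis using that by simp
    qed
    then show ?thesis by blast
  qed
qed

lemma eventually_poly_pos_coeff:
  fixes r :: "int poly"
  assumes "degree r \<le> k" "coeff r k > 0"
  shows "\<exists>z0. \<forall>z\<ge>z0. poly r z \<ge> 1"
proof -
  have "degree r = k"
    using assms by (metis le_antisym le_degree less_irrefl)
  then show ?thesis using assms eventually_poly_pos by blast
qed

text \<open>The parity of \<open>poly p x\<close> depends only on that of \<open>x\<close>, and
  \<open>v\<close>, \<open>v + 1\<close> cover both classes.\<close>

lemma poly_even_at_consecutive:
  fixes p :: "int poly"
  assumes "\<not> odd_poly p"
  shows "even (poly p v) \<or> even (poly p (v + 1))"
proof -
  have cong: "even (poly p x) = even (poly p y)" if "even (x - y)" for x y :: int
    using that by (induction p) auto
  obtain z where "even (poly p z)"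
    using assms by (auto simp: odd_poly_def)
  then show ?thesis
    using cong[of z v] cong[of z "v + 1"] by (cases "even (z - v)") auto
qed

section \<open>Growth inequalities beyond a threshold\<close>

locale growing_poly =
  fixes p :: "int poly" and d :: nat and c z0 :: int
  assumes d_ge_2: "d \<ge> 2"
    and degree_p: "degree p = d"
    and lead_pos: "lead_coeff p > 0"
    and c_ge_1: "c \<ge> 1"
    and z0_ge_1: "z0 \<ge> 1"
    and step_pos: "\<And>z. z \<ge> z0 \<Longrightarrow> poly p z < poly p (z + 1)"
    and step_mono1: "\<And>z. z \<ge> z0 \<Longrightarrow>
          poly p (z + 1) - poly p z \<le> poly p (z + 2) - poly p (z + 1)"
    and lower: "\<And>z. z \<ge> z0 \<Longrightarrow> z ^ d \<le> 2 * poly p z"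
    and step_upper: "\<And>z. z \<ge> z0 \<Longrightarrow> poly p (z + 1) - poly p z \<le> c * z ^ (d - 1)"

text \<open>Each inequality follows from a polynomial with positive leading coefficient being
  eventually at least 1: the first and second forward differences, \<open>2 p - z^d\<close>, and
  \<open>c z^(d-1)\<close> minus the first difference.\<close>

lemma growing_poly_exists:
  fixes p :: "int poly"
  assumes "degree p \<ge> 2" "lead_coeff p > 0"
  shows "\<exists>c z0. growing_poly p (degree p) c z0"
proof -
  define d where "d = degree p"
  obtain k where k: "d = Suc (Suc k)"
    using assms(1) d_def by (metis Suc_le_D numeral_2_eq_2 Suc_le_mono)
  \<comment> \<open>A backward difference with step \<open>-1\<close> is minus the forward
    difference.\<close>
  define s where "s = - backward_diff (-1) p"
  have s: "degree s \<le> Suc k" "coeff s (Suc k) = int (Suc (Suc k)) * lead_coeff p"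
    using backward_diff_degree_coeff[of p "Suc k" "-1"] k d_def by (auto simp: s_def algebra_simps)
  have ps: "poly s z = poly p (z + 1) - poly p z" for z
    by (simp add: s_def poly_backward_diff)
  define t where "t = - backward_diff (-1) s"
  have t: "degree t \<le> k" "coeff t k = int (Suc k) * coeff s (Suc k)"
    using backward_diff_degree_coeff[of s k "-1"] s(1) by (auto simp: t_def algebra_simps)
  have pt: "poly t z = poly s (z + 1) - poly s z" for z
    by (simp add: t_def poly_backward_diff)
  have lp: "coeff p d > 0" using assms d_def by simp
  have sp: "coeff s (Suc k) > 0" unfolding s(2) using assms by simp
  have tp: "coeff t k > 0" unfolding t(2) using sp by simp
  obtain z1 where z1: "\<forall>z\<ge>z1. poly s z \<ge> 1"
    using eventually_poly_pos_coeff[OF s(1) sp] by blast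
  obtain z2 where z2: "\<forall>z\<ge>z2. poly t z \<ge> 1"
    using eventually_poly_pos_coeff[OF t(1) tp] by blast
  have "\<exists>z0. \<forall>z\<ge>z0. poly (smult 2 p - monom 1 d) z \<ge> 1"
    using lp d_def
    by (intro eventually_poly_pos_coeff[of _ d]) (auto intro!: degree_diff_le simp: degree_monom_le)
  then obtain z3 where z3: "\<forall>z\<ge>z3. poly (smult 2 p - monom 1 d) z \<ge> 1"
    by blast
  define c where "c = coeff s (Suc k) + 1"
  have "\<exists>z0. \<forall>z\<ge>z0. poly (monom c (Suc k) - s) z \<ge> 1"
    using s by (intro eventually_poly_pos_coeff[of _ "Suc k"])
      (auto intro!: degree_diff_le simp: degree_monom_le c_def)
  then obtain z4 where z4: "\<forall>z\<ge>z4. poly (monom c (Suc k) - s) z \<ge> 1"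
    by blast
  define z0 where "z0 = max 1 (max (max z1 z2) (max z3 z4))"
  have "growing_poly p d c z0"
  proof
    fix z assume z: "z \<ge> z0"
    have "poly s z \<ge> 1" using z1 z by (simp add: z0_def)
    then show "poly p z < poly p (z + 1)" by (simp add: ps)
    have "poly t z \<ge> 1" using z2 z by (simp add: z0_def)
    then show "poly p (z + 1) - poly p z \<le> poly p (z + 2) - poly p (z + 1)"
      by (simp add: pt ps algebra_simps)
    have "poly (smult 2 p - monom 1 d) z \<ge> 1" using z3 z by (simp add: z0_def)
    then show "z ^ d \<le> 2 * poly p z" by (simp add: poly_monom)
    have "poly (monom c (Suc k) - s) z \<ge> 1" using z4 z by (simp add: z0_def)
    then show "poly p (z + 1) - poly p z \<le> c * z ^ (d - 1)"
      by (simp add: poly_monom ps k)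
  qed (use assms d_def sp in \<open>auto simp: c_def z0_def\<close>)
  then show ?thesis using d_def by blast
qed

context growing_poly
begin

abbreviation step :: "int \<Rightarrow> int" where
  "step z \<equiv> poly p (z + 1) - poly p z"

lemma poly_mono:
  assumes "z0 \<le> x" "x \<le> y"
  shows "poly p x \<le> poly p y"
  using assms(2)
proof (induction y rule: int_ge_induct)
  case (step i)
  then show ?case using step_pos[of i] assms(1) by simp
qed simp

lemma step_mono:
  assumes "z0 \<le> x" "x \<le> y"
  shows "step x \<le> step y"
  using assms(2)
proof (induction y rule: int_ge_induct)
  case (step i)
  then show ?case using step_mono1[of i] assms(1) by (simp add: add.assoc)
qed simp

lemma poly_diff_le_steps:
  assumes "z0 \<le> v - int k"
  shows "poly p (v + 1) - poly p (v - int k) \<le> (int k + 1) * step v"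
  using assms
proof (induction k)
  case (Suc k)
  have "step (v - int (Suc k)) \<le> step v"
    using Suc.prems by (intro step_mono) auto
  then show ?case using Suc by (simp add: algebra_simps)
qed simp

lemma power_d: "x ^ d = x * x ^ (d - 1)" for x :: int
  using d_ge_2 by (cases d) auto

lemma le_power_pred: "1 \<le> x \<Longrightarrow> x \<le> x ^ (d - 1)" for x :: int
  using d_ge_2 power_increasing[of 1 "d - 1" x] by simp

lemma square_le_power_d: "1 \<le> x \<Longrightarrow> x * x \<le> x ^ d" for x :: int
  using le_power_pred[of x] by (simp add: power_d)

end

section \<open>Alternating sums as elements of an additive monoid\<close>

text \<open>Only sums, no differences: a translation that preserves red need not have a
  red-preserving inverse.\<close>

inductive_set additive_closure :: "int set \<Rightarrow> int set" for S where
  zero: "0 \<in> additive_closure S"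
| add: "x \<in> S \<Longrightarrow> y \<in> additive_closure S \<Longrightarrow> x + y \<in> additive_closure S"

lemma additive_closure_base: "x \<in> S \<Longrightarrow> x \<in> additive_closure S"
  using additive_closure.add[OF _ additive_closure.zero] by force

lemma additive_closure_add:
  assumes "x \<in> additive_closure S" "y \<in> additive_closure S"
  shows "x + y \<in> additive_closure S"
  using assms(1)
proof induction
  case (add u w)
  then show ?case using additive_closure.add[of u S "w + y"] by (simp add: add.assoc)
qed (use assms in simp)

lemma additive_closure_mult:
  assumes "x \<in> additive_closure S"
  shows "int k * x \<in> additive_closure S"
proof (induction k)
  case (Suc k)
  then show ?case using additive_closure_add[OF assms Suc] by (simp add: algebra_simps)
qed (simp add: additive_closure.zero)

lemma additive_closure_nonneg:
  assumes "x \<in> additive_closure S" "\<And>s. s \<in> S \<Longrightarrow> 0 \<le> s"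
  shows "0 \<le> x"
  using assms(1) by induction (use assms(2) in auto)

text \<open>The terms of the \<open>j\<close>-fold backward difference with step \<open>h\<close>, split by sign: each half is
  a sum of values of \<open>g\<close>, and only their difference is small.\<close>

fun alternating_part :: "bool \<Rightarrow> (int \<Rightarrow> int) \<Rightarrow> int \<Rightarrow> nat \<Rightarrow> int \<Rightarrow> int" where
  "alternating_part b g h 0 z = (if b then g z else 0)"
| "alternating_part b g h (Suc j) z =
    alternating_part b g h j z + alternating_part (\<not> b) g h j (z - h)"

lemma alternating_part_diff:
  "alternating_part True (poly r) h j z - alternating_part False (poly r) h j z
    = poly ((backward_diff h ^^ j) r) z"
  by (induction j arbitrary: z) (simp_all add: poly_backward_diff, smt (verit))

lemma alternating_part_in_closure:
  assumes "h \<ge> 0" "\<And>x. x \<in> {z - int j * h..z} \<Longrightarrow> g x \<in> S"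
  shows "alternating_part b g h j z \<in> additive_closure S"
  using assms(2)
proof (induction j arbitrary: z b)
  case 0
  then show ?case by (auto intro: additive_closure_base additive_closure.zero)
next
  case (Suc j)
  have "alternating_part b g h j z \<in> additive_closure S"
    using assms(1) by (intro Suc.IH Suc.prems) (auto simp: algebra_simps)
  moreover have "alternating_part (\<not> b) g h j (z - h) \<in> additive_closure S"
    using assms(1) by (intro Suc.IH Suc.prems) (auto simp: algebra_simps)
  ultimately show ?case by (simp add: additive_closure_add)
qed

lemma alternating_part_le:
  assumes "h \<ge> 0" "0 \<le> B" "\<And>x. x \<in> {z - int j * h..z} \<Longrightarrow> g x \<le> B"
  shows "alternating_part b g h j z \<le> 2 ^ j * B"
  using assms(3)
proof (induction j arbitrary: z b)
  case 0
  then show ?case using assms(2) by auto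
next
  case (Suc j)
  have "alternating_part b g h j z \<le> 2 ^ j * B"
    using assms(1) by (intro Suc.IH Suc.prems) (auto simp: algebra_simps)
  moreover have "alternating_part (\<not> b) g h j (z - h) \<le> 2 ^ j * B"
    using assms(1) by (intro Suc.IH Suc.prems) (auto simp: algebra_simps)
  ultimately show ?case by simp
qed

text \<open>Choosing between \<open>T l\<close> and \<open>T' l\<close> in each of \<open>K\<close> copies writes \<open>j\<close> in base \<open>K\<close>.\<close>

lemma additive_closure_digits:
  assumes "K \<ge> 1"
    and "\<And>l. l < m \<Longrightarrow> T l \<in> additive_closure S"
    and "\<And>l. l < m \<Longrightarrow> T' l \<in> additive_closure S"
    and "\<And>l. l < m \<Longrightarrow> T' l - T l = q * int K ^ l"
    and "j < K ^ m"
  shows "(\<Sum>l<m. int K * T l) + q * int j \<in> additive_closure S"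
  using assms(2-)
proof (induction m arbitrary: j)
  case 0
  then show ?case by (simp add: additive_closure.zero)
next
  case (Suc m)
  define e where "e = j div K ^ m"
  define r where "r = j mod K ^ m"
  have r: "r < K ^ m" using assms(1) by (simp add: r_def)
  have e: "e < K"
    using Suc.prems(4) assms(1) by (simp add: e_def less_mult_imp_div_less)
  have j: "int j = int e * int K ^ m + int r"
    unfolding e_def r_def by (metis div_mult_mod_eq of_nat_add of_nat_mult of_nat_power)
  have "(\<Sum>l<m. int K * T l) + q * int r \<in> additive_closure S"
    by (rule Suc.IH) (use Suc.prems r in auto)
  moreover have "int (K - e) * T m + int e * T' m \<in> additive_closure S"
    using Suc.prems by (intro additive_closure_add additive_closure_mult) auto
  ultimately have "((\<Sum>l<m. int K * T l) + q * int r) + (int (K - e) * T m + int e * T' m)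
      \<in> additive_closure S"
    by (rule additive_closure_add)
  also have "int (K - e) * T m + int e * T' m = int K * T m + int e * (T' m - T m)"
    using e by (simp add: of_nat_diff algebra_simps)
  also have "T' m - T m = q * int K ^ m"
    using Suc.prems by simp
  finally show ?case
    by (simp add: j algebra_simps)
qed

section \<open>Colourings without monochromatic solutions\<close>

lemma first_change:
  fixes a b :: int
  assumes "a \<le> b" "P a" "\<exists>x\<in>{a..b}. \<not> P x"
  obtains v where "a \<le> v" "v < b" "\<And>z. z \<in> {a..v} \<Longrightarrow> P z" "\<not> P (v + 1)"
proof -
  have "(\<forall>z\<in>{a..b}. P z) \<or> (\<exists>v\<ge>a. v < b \<and> (\<forall>z\<in>{a..v}. P z) \<and> \<not> P (v + 1))"
    using assms(1)
  proof (induction b rule: int_ge_induct)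
    case base
    then show ?case using assms(2) by simp
  next
    case (step i)
    have "{a..i + 1} = insert (i + 1) {a..i}" using step.hyps by auto
    then show ?case using step by (cases "P (i + 1)") (auto intro: less_trans)
  qed
  then show ?thesis using assms(3) that by blast
qed

definition mono_free :: "int poly \<Rightarrow> int \<Rightarrow> int \<Rightarrow> (int \<Rightarrow> bool) \<Rightarrow> bool" where
  "mono_free p n N P \<longleftrightarrow>
    (\<forall>x\<in>{n..N}. \<forall>y\<in>{n..N}. \<forall>z\<in>{n..N}. x + y = poly p z \<longrightarrow> \<not> (P x = P y \<and> P y = P z))"

lemma mono_free_compl: "mono_free p n N P \<Longrightarrow> mono_free p n N (\<lambda>x. \<not> P x)"
  by (auto simp: mono_free_def)

lemma mono_freeD:
  assumes "mono_free p n N P" "x + y = poly p z" "x \<in> {n..N}" "y \<in> {n..N}" "z \<in> {n..N}"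
    "P x = P z"
  shows "P y \<noteq> P z"
  using assms unfolding mono_free_def by blast

text \<open>Reflecting first in \<open>poly p z / 2\<close> and then in \<open>poly p w / 2\<close> is a translation.\<close>

lemma mono_free_shift:
  assumes free: "mono_free p n N P" and "0 \<le> n"
    and "P x" "P z" "\<not> P w" "z \<in> {n..N}" "w \<in> {n..N}" "poly p z \<le> N" "poly p w \<le> N"
    and "n \<le> x" "x \<le> poly p z - n" "n \<le> x + poly p w - poly p z"
  shows "P (x + poly p w - poly p z)"
proof -
  have "P (poly p z - x) \<noteq> P z"
    by (rule mono_freeD[OF free, of x]) (use assms in auto)
  then have "\<not> P (poly p z - x)"
    using assms by simp
  then have "P (x + poly p w - poly p z) \<noteq> P w"
    by (intro mono_freeD[OF free, of "poly p z - x"]) (use assms in auto)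
  then show ?thesis
    using assms by simp
qed

context growing_poly
begin

text \<open>All generators are nonnegative because \<open>p\<close> increases, so the partial sums
  stay between \<open>x\<close> and \<open>x + e\<close>, and the bound on \<open>x + e\<close>
  alone licenses every single translation.\<close>

lemma shift_by_closure:
  assumes free: "mono_free p n N P" and "z0 \<le> n" "n \<le> s"
    and "poly p (v + 1) \<le> N" "v + 1 \<le> N"
    and block: "\<And>z. z \<in> {s..v} \<Longrightarrow> P z" and "\<not> P (v + 1)" "s \<le> v"
    and e: "e \<in> additive_closure ((\<lambda>z. poly p (v + 1) - poly p z) ` {s..v})"
    and "P x" "n \<le> x" "x + e \<le> poly p (v + 1) - n"
  shows "P (x + e)"
  using e assms(10-)
proof (induction arbitrary: x)
  case zero
  then show ?case by simp
next
  case (add g e)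
  then obtain z where z: "z \<in> {s..v}" "g = poly p (v + 1) - poly p z" by auto
  have mono: "poly p z' \<le> poly p (v + 1)" if "z' \<in> {s..v}" for z'
    using that assms by (intro poly_mono) auto
  have "0 \<le> e"
    using add.hyps(2) by (rule additive_closure_nonneg) (use mono in auto)
  have "P (x + poly p (v + 1) - poly p z)"
    by (rule mono_free_shift[OF free])
      (use assms z add.prems \<open>0 \<le> e\<close> mono[OF z(1)] z0_ge_1 in auto)
  then have "P (x + g)" by (simp add: z algebra_simps)
  then have "P (x + g + e)"
    by (rule add.IH) (use add.prems mono[OF z(1)] z in auto)
  then show ?case by (simp add: add.assoc)
qed

text \<open>Chosen for the estimate \<open>4 * Base \<le> v ^ d\<close> below: \<open>2^d\<close>
  copies, the bound \<open>2^d (d + 1) D 2^l\<close> for each part, a geometric sum below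
  \<open>2^(m+1)\<close>, and \<open>c\<close> from \<open>D \<le> c v^(d-1)\<close>.\<close>

definition growth_bound :: int where
  "growth_bound = 4 * (2 ^ (2 * d + 1) * (int d + 1)) * c"

definition top_diff :: int where
  "top_diff = fact d * lead_coeff p"

lemma growth_bound_ge: "growth_bound \<ge> 2 * int d" "growth_bound \<ge> 1"
proof -
  have "(1::int) \<le> 2 ^ (2 * d + 1)" by (rule one_le_power) simp
  then have "1 * (int d + 1) \<le> 2 ^ (2 * d + 1) * (int d + 1)"
    by (intro mult_right_mono) auto
  moreover have "1 * c \<ge> 1" using c_ge_1 by simp
  moreover from calculation have "(4 * (int d + 1)) * 1 \<le> growth_bound"
    unfolding growth_bound_def by (intro mult_mono) auto
  ultimately show "growth_bound \<ge> 2 * int d" "growth_bound \<ge> 1" by auto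
qed

lemma top_diff_ge_1: "top_diff \<ge> 1"
  using lead_pos unfolding top_diff_def
  by (metis fact_gt_zero int_one_le_iff_zero_less mult_pos_pos)

text \<open>Since \<open>g\<close> is a constant minus \<open>p\<close>, the signs are reversed. By
  monotonicity \<open>g\<close> is largest at the left end, where convexity bounds it by
  \<open>d h + 1\<close> copies of \<open>step v\<close>.\<close>

lemma alternating_part_steps:
  assumes "h \<ge> 0" "z0 \<le> v - int d * h"
  defines "g \<equiv> \<lambda>z. poly p (v + 1) - poly p z"
  shows "alternating_part False g h d v - alternating_part True g h d v = top_diff * h ^ d"
    and "alternating_part b g h d v \<le> 2 ^ d * ((int d * h + 1) * step v)"
proof -
  define r where "r = [:poly p (v + 1):] - p"
  have g: "g = poly r" by (auto simp: g_def r_def)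
  have "degree r \<le> d" "coeff r d = - lead_coeff p"
    using d_ge_2 degree_p unfolding r_def
    by (auto intro!: degree_diff_le simp: coeff_pCons split: nat.splits)
  then show "alternating_part False g h d v - alternating_part True g h d v = top_diff * h ^ d"
    using alternating_part_diff[of r h d v] poly_backward_diff_funpow_degree[of r d h v]
    by (simp add: g top_diff_def algebra_simps)
  have dh: "0 \<le> int d * h" using assms(1) by simp
  have "0 \<le> step v" using step_pos[of v] dh assms(2) by simp
  show "alternating_part b g h d v \<le> 2 ^ d * ((int d * h + 1) * step v)"
  proof (rule alternating_part_le[OF assms(1)])
    show "0 \<le> (int d * h + 1) * step v"
      using dh \<open>0 \<le> step v\<close> by simp
  next
    fix x assume x: "x \<in> {v - int d * h..v}"
    have "g x \<le> g (v - int d * h)"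
      using poly_mono[of "v - int d * h" x] x assms(2) by (simp add: g_def)
    also have "\<dots> \<le> (int d * h + 1) * step v"
      using poly_diff_le_steps[of v "nat (int d * h)"] dh assms(2) by (simp add: g_def)
    finally show "g x \<le> (int d * h + 1) * step v" .
  qed
qed

text \<open>The numbers \<open>Base + q j\<close> approximate every residue modulo \<open>D\<close>
  with error below \<open>q\<close>. As \<open>D\<close> itself is a generator, adding its multiples
  comes within \<open>q\<close> of any target above \<open>Base\<close>; the length of the block
  absorbs the error.\<close>

lemma long_block_closure_hits:
  assumes "z0 \<le> s" "2 * s \<le> v" "c * growth_bound ^ d \<le> v" "4 + 4 * top_diff \<le> v"
  shows "\<exists>e \<in> additive_closure ((\<lambda>z. poly p (v + 1) - poly p z) ` {s..v}).
           \<exists>x\<in>{s..v}. s + e = poly p v - x"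
proof -
  define g where "g = (\<lambda>z. poly p (v + 1) - poly p z)"
  define S where "S = g ` {s..v}"
  define D where "D = step v"
  define q where "q = top_diff"
  define B where "B = growth_bound"
  have s1: "1 \<le> s" and v1: "1 \<le> v" using assms(1,2) z0_ge_1 by auto
  have D: "0 < D" "D \<le> c * v ^ (d - 1)"
    using step_pos[of v] step_upper[of v] assms(1,2) s1 by (auto simp: D_def)
  have q1: "1 \<le> q" using top_diff_ge_1 by (simp add: q_def)
  have B1: "1 \<le> B" "2 * int d \<le> B" using growth_bound_ge by (auto simp: B_def)
  have "B \<le> B ^ d" using B1(1) d_ge_2 by (intro self_le_power) auto
  also have "1 * B ^ d \<le> c * B ^ d" using c_ge_1 B1 by (intro mult_right_mono) auto
  finally have "B \<le> v" using assms(3) by (simp add: B_def)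
  define k where "k = nat (v div B)"
  have "1 \<le> k"
    using \<open>B \<le> v\<close> B1(1) by (simp add: k_def pos_imp_zdiv_pos_iff Suc_le_eq)
  \<comment> \<open>The largest scale \<open>2^m \<le> v / B\<close>: by \<open>H1\<close>
    differences with steps up to \<open>2^m\<close> fit into the block, and by \<open>H2\<close>
    there are enough digits to cover all residues modulo \<open>D\<close>.\<close>
  then obtain m where m: "2 ^ m \<le> k" "k < 2 ^ (m + 1)"
    using ex_power_ivl1[of 2 k] by auto
  have k: "int k = v div B" using v1 B1 by (simp add: k_def pos_imp_zdiv_nonneg_iff)
  have "B * 2 ^ m \<le> B * int k"
    using m(1) B1 by (intro mult_left_mono) (auto simp flip: of_nat_le_iff)
  also have "\<dots> \<le> v" unfolding k using B1 pos_mod_sign[of B v]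
    by (simp flip: minus_mod_eq_mult_div)
  finally have H1: "B * 2 ^ m \<le> v" .
  have "int k + 1 \<le> 2 ^ (m + 1)"
    using m(2) by (metis Suc_leI of_nat_Suc of_nat_le_iff of_nat_numeral of_nat_power add.commute)
  have "v < B * (v div B + 1)"
    using B1 pos_mod_bound[of B v] by (simp add: distrib_left flip: minus_mod_eq_mult_div)
  also have "\<dots> \<le> B * 2 ^ (m + 1)"
    using \<open>int k + 1 \<le> 2 ^ (m + 1)\<close> B1 by (intro mult_left_mono) (auto simp: k)
  finally have H2: "v < B * 2 ^ (m + 1)" .
  have range: "s \<le> v - int d * 2 ^ l" if "l \<le> m" for l
  proof -
    have "2 * int d * 2 ^ l \<le> B * 2 ^ m"
      using B1 that by (intro mult_mono power_increasing) auto
    then show ?thesis using H1 assms(2) by simp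
  qed
  \<comment> \<open>With step \<open>2^l\<close> the two halves differ by
    \<open>q * (2^d)^l\<close>, a digit weight in base \<open>2^d\<close>.\<close>
  define T where "T b l = alternating_part b g (2 ^ l) d v" for b l
  have Tin: "T b l \<in> additive_closure S" if "l < Suc m" for b l
    unfolding T_def S_def by (rule alternating_part_in_closure) (use range[of l] that in auto)
  have Tdiff: "T False l - T True l = q * int (2 ^ d) ^ l" if "l < Suc m" for l
    using alternating_part_steps(1)[of "2 ^ l" v] range[of l] that assms(1)
    by (simp add: T_def g_def q_def mult.commute flip: power_mult)
  have Tle: "T b l \<le> 2 ^ d * ((int d + 1) * D) * 2 ^ l" if "l < Suc m" for b l
  proof -
    have "T b l \<le> 2 ^ d * ((int d * 2 ^ l + 1) * D)"
      using alternating_part_steps(2)[of "2 ^ l" v b] range[of l] that assms(1)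
      by (simp add: T_def g_def D_def)
    also have "int d * 2 ^ l + 1 \<le> (int d + 1) * 2 ^ l"
      by (simp add: algebra_simps)
    finally show ?thesis using D by (simp add: mult_ac mult_left_mono mult_right_mono)
  qed
  define Base where "Base = (\<Sum>l<Suc m. int (2 ^ d) * T True l)"
  have closure: "Base + q * int j \<in> additive_closure S" if "j < (2 ^ d) ^ Suc m" for j
    unfolding Base_def by (rule additive_closure_digits[where T' = "T False"])
      (use Tin Tdiff that in auto)
  have "Base \<le> (\<Sum>l<Suc m. 2 ^ d * (2 ^ d * ((int d + 1) * D) * 2 ^ l))"
    unfolding Base_def using Tle by (intro sum_mono) (simp add: mult.assoc)
  also have "\<dots> = 2 ^ (2 * d) * (int d + 1) * D * (\<Sum>l<Suc m. 2 ^ l)"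
    unfolding sum_distrib_left by (intro sum.cong) (simp_all add: mult_2_right power_add mult_ac)
  also have "(\<Sum>l<Suc m. (2::int) ^ l) = 2 ^ Suc m - 1"
    by (induction m) auto
  also have "2 ^ (2 * d) * (int d + 1) * D * (2 ^ Suc m - 1)
      \<le> 2 ^ (2 * d) * (int d + 1) * D * 2 ^ Suc m"
    using D by (intro mult_left_mono) auto
  finally have "4 * c * Base \<le> 4 * c * (2 ^ (2 * d) * (int d + 1) * D * 2 ^ Suc m)"
    using c_ge_1 by (intro mult_left_mono) auto
  also have "\<dots> = B * 2 ^ m * D"
    by (simp add: B_def growth_bound_def)
  also have "\<dots> \<le> v * (c * v ^ (d - 1))"
    using H1 D v1 by (intro mult_mono) auto
  also have "\<dots> = c * v ^ d"
    unfolding power_d[of v] by (rule mult.left_commute)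
  finally have "c * (4 * Base) \<le> c * v ^ d"
    by (simp only: mult.left_commute[of c] mult.assoc)
  then have Base: "4 * Base \<le> v ^ d"
    using c_ge_1 by simp
  \<comment> \<open>\<open>c B^d \<le> v\<close> turns \<open>D \<le> c v^(d-1)\<close> into
    \<open>B^d D \<le> v^d\<close>, and \<open>H2\<close> bounds \<open>v^d\<close>; cancelling
    \<open>B^d\<close> leaves the number of available \<open>j\<close>.\<close>
  have "B ^ d * D \<le> B ^ d * (c * v ^ (d - 1))"
    using D B1 by (intro mult_left_mono) auto
  also have "\<dots> = (c * B ^ d) * v ^ (d - 1)" by simp
  also have "\<dots> \<le> v * v ^ (d - 1)"
    using assms(3) v1 by (intro mult_right_mono) (auto simp: B_def)
  also have "\<dots> \<le> (B * 2 ^ (m + 1)) ^ d"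
    using H2 v1 by (subst power_d[symmetric], intro power_mono) auto
  also have "\<dots> = B ^ d * (2 ^ d) ^ Suc m"
    by (metis Suc_eq_plus1 mult.commute power_mult power_mult_distrib)
  finally have D_le: "D \<le> (2 ^ d) ^ Suc m"
    by (rule mult_left_le_imp_le) (use B1 in simp)
  have "4 * v + 4 * q \<le> v * 4 + v * (4 * q)"
    using v1 q1 by simp
  also have "\<dots> = v * (4 + 4 * q)" by (simp add: algebra_simps)
  also have "\<dots> \<le> v * v" using assms(4) v1 by (intro mult_left_mono) (auto simp: q_def)
  also have "\<dots> \<le> v ^ d" using square_le_power_d[OF v1] .
  finally have "4 * v + 4 * q \<le> v ^ d" .
  define X where "X = poly p v - 2 * s - q - Base"
  have "0 \<le> X"
    using lower[of v] assms(1,2) s1 Base \<open>4 * v + 4 * q \<le> v ^ d\<close> by (simp add: X_def)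
  \<comment> \<open>Splitting \<open>X\<close> into a multiple of \<open>D\<close>, a multiple of
    \<open>q\<close> and \<open>r mod q\<close> leaves \<open>x = s + q + r mod q\<close>.\<close>
  define r where "r = X mod D"
  define j where "j = nat (r div q)"
  have r: "0 \<le> r" "r < D" using D by (auto simp: r_def)
  have j: "int j = r div q" using r q1 by (simp add: j_def pos_imp_zdiv_nonneg_iff)
  have "int j \<le> r" unfolding j using r q1 zdiv_mono2[of r 1 q] by simp
  then have "int j < int ((2 ^ d) ^ Suc m)" using r D_le by simp
  then have "j < (2 ^ d) ^ Suc m" by (simp only: of_nat_less_iff)
  then have "Base + q * int j \<in> additive_closure S" by (rule closure)
  moreover have "int (nat (X div D)) * D \<in> additive_closure S"
    unfolding S_def D_def using s1 assms(2)
    by (intro additive_closure_mult additive_closure_base) (auto simp: g_def)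
  ultimately have e: "(Base + q * int j) + int (nat (X div D)) * D \<in> additive_closure S"
    by (rule additive_closure_add)
  have Xdiv: "int (nat (X div D)) * D = X - r"
    using \<open>0 \<le> X\<close> D by (simp add: r_def pos_imp_zdiv_nonneg_iff minus_mod_eq_div_mult)
  have qj: "q * int j = r - r mod q"
    by (simp add: j minus_mod_eq_mult_div)
  have "0 \<le> r mod q" "r mod q < q" using q1 by auto
  then have "s + q + r mod q \<in> {s..v}"
    using assms(2,4) q1 by (simp add: q_def)
  moreover have "s + ((Base + q * int j) + int (nat (X div D)) * D) = poly p v - (s + q + r mod q)"
    unfolding Xdiv qj by (simp add: X_def)
  ultimately show ?thesis
    using e unfolding S_def g_def by blast
qed

text \<open>The sum \<open>s + e = p(v) - x\<close> is red as a translate of \<open>s\<close>, but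
  blue as the partner of the red \<open>x\<close> with respect to the red \<open>v\<close>.\<close>

lemma long_block_impossible:
  assumes free: "mono_free p n N P" and "z0 \<le> n" "n \<le> s" "2 * s \<le> v"
    and "poly p (v + 1) \<le> N" "v + 1 \<le> N"
    and block: "\<And>z. z \<in> {s..v} \<Longrightarrow> P z" and "\<not> P (v + 1)"
    and "c * growth_bound ^ d \<le> v" "4 + 4 * top_diff \<le> v"
  shows False
proof -
  obtain e x where e: "e \<in> additive_closure ((\<lambda>z. poly p (v + 1) - poly p z) ` {s..v})"
    and x: "x \<in> {s..v}" "s + e = poly p v - x"
    using long_block_closure_hits[of s v] assms by auto
  have mono: "poly p z \<le> poly p (v + 1)" if "z \<in> {s..v}" for z
    using that assms by (intro poly_mono) auto
  have "0 \<le> e"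
    using e by (rule additive_closure_nonneg) (use mono in auto)
  have sv: "s \<le> v" "v \<in> {s..v}" "s \<in> {s..v}" using assms z0_ge_1 by auto
  have "P (s + e)"
    by (rule shift_by_closure[OF free assms(2,3,5,6) block \<open>\<not> P (v + 1)\<close> sv(1) e])
      (use assms x mono[OF sv(2)] sv in auto)
  moreover have "P (s + e) \<noteq> P v"
    by (rule mono_freeD[OF free, of x])
      (use assms x mono[OF sv(2)] sv \<open>0 \<le> e\<close> block z0_ge_1 in auto)
  ultimately show False using block sv by auto
qed

text \<open>The change at \<open>v\<close> lets red move up by \<open>A\<close>, the one at
  \<open>u\<close> lets it move down by \<open>B\<close>. The bounds \<open>small\<close> and
  \<open>big\<close> keep a window near \<open>p(v) / 2\<close> within the range of both
  moves.\<close>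

lemma two_changes_impossible:
  assumes free: "mono_free p n N P" and "z0 \<le> n" "n \<le> v" "v < u"
    and N: "poly p (u + 1) \<le> N" "u + 1 \<le> N"
    and v: "P v" "\<not> P (v + 1)" and u: "\<not> P u" "P (u + 1)"
    and small: "8 * (step v + step u) \<le> poly p v" and big: "4 * v \<le> poly p v"
    and even: "even (poly p v) \<or> even (poly p (v + 1))"
  shows False
proof -
  define A where "A = step v"
  define B where "B = step u"
  have AB: "0 < A" "0 < B" "8 * (A + B) \<le> poly p v"
    using step_pos[of v] step_pos[of u] assms by (auto simp: A_def B_def)
  have n: "1 \<le> n" using assms(2) z0_ge_1 by simp
  have pv: "poly p (v + 1) = poly p v + A" and pu: "poly p (u + 1) = poly p u + B"
    by (auto simp: A_def B_def)
  have vu: "poly p (v + 1) \<le> poly p u"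
    using assms by (intro poly_mono) auto
  \<comment> \<open>Half of \<open>p(v)\<close> is blue, and its partner for the blue
    \<open>v + 1\<close> is red. Half of \<open>p(v+1)\<close> is red, and its partner for the red
    \<open>v\<close> is blue.\<close>
  obtain y where y: "\<not> P y" "P (y + A)" "poly p v - A \<le> 2 * y" "2 * y \<le> poly p v"
  proof (cases "even (poly p v)")
    case True
    then obtain y where y: "poly p v = 2 * y" by (elim evenE)
    have 1: "\<not> P y"
      using mono_freeD[OF free, of y y v] y v AB pv pu vu N big assms(2-4) n by auto
    have "P (y + A) \<noteq> P (v + 1)"
      by (rule mono_freeD[OF free, of y])
        (use 1 y v AB pv pu vu N big assms(2-4) n in auto)
    then show thesis using that[of y] 1 v y AB by auto
  next
    case False
    then have "even (poly p (v + 1))" using even by simp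
    then obtain t where t: "poly p (v + 1) = 2 * t" by (elim evenE)
    have 1: "P t"
      using mono_freeD[OF free, of t t "v + 1"] t v AB pv pu vu N big assms(2-4) n by auto
    have "P (t - A) \<noteq> P v"
      by (rule mono_freeD[OF free, of t])
        (use 1 t v AB pv pu vu N big assms(2-4) n in auto)
    then show thesis using that[of "t - A"] 1 v t pv AB by auto
  qed
  \<comment> \<open>The red part of a window of length \<open>A + B\<close> is mapped into itself by the rotation that adds \<open>A\<close>
     or subtracts \<open>B\<close>, hence onto itself.\<close>
  define W where "W = {y..<y + A + B}"
  define f where "f x = (if x < y + B then x + A else x - B)" for x
  define R where "R = {x \<in> W. P x}"
  have "finite R" unfolding R_def W_def by (rule finite_subset[of _ "{y..<y + A + B}"]) auto
  have inj: "inj_on f W"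
    by (auto simp: inj_on_def W_def f_def split: if_splits)
  have "f x \<in> R" if "x \<in> R" for x
  proof -
    have x: "y \<le> x" "x < y + A + B" "P x" using that by (auto simp: R_def W_def)
    have "P (f x)"
    proof (cases "x < y + B")
      case True
      have "P (x + poly p (v + 1) - poly p v)"
        by (rule mono_free_shift[OF free])
          (use True x y v AB pv pu vu N big assms(2-4) n in auto)
      then show ?thesis using True pv by (simp add: f_def)
    next
      case False
      have "P (x + poly p u - poly p (u + 1))"
        by (rule mono_free_shift[OF free])
          (use False x y u AB pv pu vu N big assms(2-4) n in auto)
      then show ?thesis using False pu by (simp add: f_def)
    qed
    then show ?thesis using x AB by (auto simp: R_def W_def f_def)
  qed
  then have "f ` R \<subseteq> R" by blast
  moreover have "inj_on f R"
    using inj by (rule inj_on_subset) (auto simp: R_def)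
  ultimately have "f ` R = R"
    by (rule endo_inj_surj[OF \<open>finite R\<close>])
  \<comment> \<open>The red point \<open>y + A = f y\<close> has a red preimage, which injectivity
    on \<open>W\<close> identifies with the blue \<open>y\<close>.\<close>
  moreover have "f y \<in> R" using y AB by (auto simp: R_def W_def f_def)
  ultimately obtain x where x: "x \<in> R" "f x = f y"
    by (metis imageE)
  have "x = y"
    using inj_onD[OF inj x(2)] x(1) AB by (auto simp: R_def W_def)
  then show False using x(1) y(1) by (simp add: R_def)
qed

section \<open>Thresholds for \<open>n\<close> and conclusion\<close>

lemma mono_free_impossible:
  assumes "\<not> odd_poly p"
    and "z0 \<le> n" "c * growth_bound ^ d \<le> n" "4 + 4 * top_diff \<le> n"
    and n1: "4 * (2 + c * 2 ^ (d - 1)) \<le> n" and n2: "32 * c * 3 ^ (d - 1) \<le> n"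
    and free: "mono_free p n N P" and N: "N = poly p M" and M: "M = (poly p n + 1) div 2"
    and "P n"
  shows False
proof -
  have n8: "8 \<le> n" using assms(4) top_diff_ge_1 by simp
  have big: "4 * z \<le> poly p z" if "n \<le> z" for z
  proof -
    have "8 * z \<le> z * z" using that n8 by (intro mult_right_mono) auto
    also have "\<dots> \<le> z ^ d" using that n8 by (intro square_le_power_d) auto
    also have "\<dots> \<le> 2 * poly p z" using that assms(2) by (intro lower) auto
    finally show ?thesis by simp
  qed
  have M2: "poly p n \<le> 2 * M" "2 * M \<le> poly p n + 1" unfolding M by auto
  have nM: "n \<le> M" using M2 big[of n] n8 by simp
  have MN: "M \<le> N" using big[OF nM] nM n8 unfolding N by simp
  have le_N: "poly p z \<le> N" if "n \<le> z" "z \<le> M" for z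
    unfolding N using that assms(2) by (intro poly_mono) auto
  have "\<exists>x\<in>{n..M}. \<not> P x"
  proof (rule ccontr)
    assume "\<not> ?thesis"
    then have all: "P x" if "x \<in> {n..M}" for x using that by blast
    have m: "poly p n - M \<in> {n..M}" using M2 big[of n] n8 by auto
    have "P (poly p n - M) \<noteq> P n"
      by (rule mono_freeD[OF free, of M]) (use nM MN m all in auto)
    then show False using all[OF m] \<open>P n\<close> by simp
  qed
  then obtain v where v: "n \<le> v" "v < M" "\<And>z. z \<in> {n..v} \<Longrightarrow> P z" "\<not> P (v + 1)"
    using first_change[of n M P, OF nM \<open>P n\<close>] by metis
  have v2: "v < 2 * n"
  proof (rule ccontr)
    assume "\<not> v < 2 * n"
    then show False
      using v assms(2-4) le_N[of "v + 1"] MN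
      by (intro long_block_impossible[OF free assms(2) order_refl, of v]) auto
  qed
  \<comment> \<open>As \<open>v < 2 n\<close>, \<open>n1\<close> keeps the red point
    \<open>v + step v\<close> below \<open>M\<close>. So the next change has
    \<open>u + 1 \<le> M\<close>, and \<open>p(u+1) \<le> p(M) = N\<close> makes it usable.\<close>
  have "step v \<le> c * v ^ (d - 1)"
    using v assms(2) by (intro step_upper) auto
  also have "\<dots> \<le> c * (2 * n) ^ (d - 1)"
    using v v2 n8 c_ge_1 by (intro mult_left_mono power_mono) auto
  finally have "4 * (v + step v) \<le> 4 * (2 * n + c * 2 ^ (d - 1) * n ^ (d - 1))"
    using v2 by (simp add: power_mult_distrib)
  also have "\<dots> \<le> 4 * (2 * n ^ (d - 1) + c * 2 ^ (d - 1) * n ^ (d - 1))"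
    using le_power_pred[of n] n8 by simp
  also have "\<dots> = (4 * (2 + c * 2 ^ (d - 1))) * n ^ (d - 1)"
    by (simp add: algebra_simps)
  also have "\<dots> \<le> n * n ^ (d - 1)"
    using n1 n8 by (intro mult_right_mono) auto
  also have "\<dots> \<le> 2 * poly p n"
    using lower[OF assms(2)] by (simp add: power_d)
  finally have vM: "v + step v \<le> M" using M2 by simp
  have "P v" using v by simp
  have sv: "0 < step v" using step_pos[of v] v assms(2) by simp
  have "P (v + poly p (v + 1) - poly p v)"
    by (rule mono_free_shift[OF free])
      (use v \<open>P v\<close> sv n8 MN le_N[of v] le_N[of "v + 1"] big[of v] in auto)
  then have "P (v + step v)" by (simp add: algebra_simps)
  moreover have "v + 1 \<le> v + step v" using sv by simp
  ultimately obtain u where u: "v + 1 \<le> u" "u < v + step v"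
      "\<And>z. z \<in> {v + 1..u} \<Longrightarrow> \<not> P z" "P (u + 1)"
    using first_change[of "v + 1" "v + step v" "\<lambda>x. \<not> P x"] v(4)
    by (metis atLeastAtMost_iff order_refl)
  have uM: "u + 1 \<le> M" using u vM by simp
  have u2: "u < 2 * (v + 1)"
  proof (rule ccontr)
    assume "\<not> u < 2 * (v + 1)"
    then show False
      using v u uM assms(2-4) le_N[of "u + 1"] MN
      by (intro long_block_impossible[OF mono_free_compl[OF free] assms(2), of "v + 1" u]) auto
  qed
  \<comment> \<open>Applied to \<open>v\<close> and to \<open>u \<le> 2 v + 1 \<le> 3 v\<close>;
    \<open>n2\<close> then yields the hypothesis \<open>small\<close>.\<close>
  have step3: "step w \<le> c * 3 ^ (d - 1) * v ^ (d - 1)" if "v \<le> w" "w \<le> 3 * v" for w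
  proof -
    have "step w \<le> c * w ^ (d - 1)"
      using that v assms(2) by (intro step_upper) auto
    also have "\<dots> \<le> c * (3 * v) ^ (d - 1)"
      using that v n8 c_ge_1 by (intro mult_left_mono power_mono) auto
    finally show ?thesis by (simp add: power_mult_distrib)
  qed
  have "16 * (step v + step u) \<le> (32 * c * 3 ^ (d - 1)) * v ^ (d - 1)"
    using step3[of v] step3[of u] u u2 v n8 by simp
  also have "\<dots> \<le> v * v ^ (d - 1)"
    using n2 v n8 by (intro mult_right_mono) auto
  also have "\<dots> \<le> 2 * poly p v"
    using lower[of v] v assms(2) by (simp add: power_d)
  finally have "8 * (step v + step u) \<le> poly p v" by simp
  then show False
    using v u uM MN le_N[of "u + 1"] \<open>P v\<close> big[of v]
    by (intro two_changes_impossible[OF free assms(2), of v u] poly_even_at_consecutive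
        \<open>\<not> odd_poly p\<close>) auto
qed

text \<open>Exchanging the colours if necessary makes \<open>n\<close> red.\<close>

lemma eventually_not_mono_free:
  assumes "\<not> odd_poly p"
  shows "\<exists>n0. \<forall>n\<ge>n0. \<forall>P. \<not> mono_free p n (poly p ((poly p n + 1) div 2)) P"
proof (intro exI allI impI notI)
  fix n P
  assume n: "n \<ge> Max {z0, c * growth_bound ^ d, 4 + 4 * top_diff,
      4 * (2 + c * 2 ^ (d - 1)), 32 * c * 3 ^ (d - 1)}"
    and free: "mono_free p n (poly p ((poly p n + 1) div 2)) P"
  show False
  proof (cases "P n")
    case True
    then show False
      using mono_free_impossible[OF assms _ _ _ _ _ free refl refl] n by auto
  next
    case False
    then show False
      using mono_free_impossible[OF assms _ _ _ _ _ mono_free_compl[OF free] refl refl] n by auto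
  qed
qed

end

lemma ceiling_half_of_int: "\<lceil>(1/2) * real_of_int k\<rceil> = (k + 1) div 2"
  by linarith

theorem theorem1p2:
  fixes p :: "int poly"
  assumes "\<not> odd_poly p"
    and "degree p \<ge> 2"
    and "lead_coeff p > 0"
  shows "\<exists>n\<^sub>0::int. \<forall>n\<ge>n\<^sub>0.
    \<forall>\<phi> \<in> {n..poly p \<lceil>(1/2) * real_of_int (poly p n)\<rceil>} \<rightarrow> {1, 2::nat}.
      \<exists>x \<in> {n..poly p \<lceil>(1/2) * real_of_int (poly p n)\<rceil>}.
      \<exists>y \<in> {n..poly p \<lceil>(1/2) * real_of_int (poly p n)\<rceil>}.
      \<exists>z \<in> {n..poly p \<lceil>(1/2) * real_of_int (poly p n)\<rceil>}.
        \<phi> x = \<phi> y \<and> \<phi> y = \<phi> z \<and> x + y = poly p z"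
proof -
  obtain c z0 where "growing_poly p (degree p) c z0"
    using growing_poly_exists assms by blast
  then interpret growing_poly p "degree p" c z0 .
  obtain n0 where n0: "\<not> mono_free p n (poly p ((poly p n + 1) div 2)) P" if "n \<ge> n0" for n P
    using eventually_not_mono_free[OF assms(1)] by blast
  show ?thesis
    unfolding ceiling_half_of_int
  proof (intro exI[of _ n0] allI impI ballI)
    fix n \<phi>
    assume n: "n \<ge> n0"
      and \<phi>: "\<phi> \<in> {n..poly p ((poly p n + 1) div 2)} \<rightarrow> {1, 2::nat}"
    \<comment> \<open>With only the values 1 and 2, the predicate \<open>\<phi> x = 1\<close>
      determines the colour.\<close>
    have same: "\<phi> x = \<phi> y"
      if "x \<in> {n..poly p ((poly p n + 1) div 2)}" "y \<in> {n..poly p ((poly p n + 1) div 2)}"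
        "(\<phi> x = 1) = (\<phi> y = 1)" for x y
      using funcset_mem[OF \<phi> that(1)] funcset_mem[OF \<phi> that(2)] that(3) by auto
    show "\<exists>x\<in>{n..poly p ((poly p n + 1) div 2)}. \<exists>y\<in>{n..poly p ((poly p n + 1) div 2)}.
        \<exists>z\<in>{n..poly p ((poly p n + 1) div 2)}. \<phi> x = \<phi> y \<and> \<phi> y = \<phi> z \<and> x + y = poly p z"
      using n0[OF n, of "\<lambda>x. \<phi> x = 1"] same unfolding mono_free_def by meson
  qed
qed

end
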